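(* A tree $T$ is $12$-representable if and only if it is a double caterpillar.
   Context: All graphs are simple and finite. For a word $w$ over the positive integers, $A(w)$ is the set of letters occurring in $w$; for $B\subseteq A(w)$, $w_B$ is the word obtained from $w$ by deleting all letters not in $B$. A word $w=w_1\cdots w_m$ has a $12$-match if $w_i<w_{i+1}$ for some $i$. A labeled graph $G=([n],E)$, with $[n]=\{1,\ldots,n\}$, is $12$-representable if there is a word $w\in[n]^*$ with $A(w)=[n]$ such that for all distinct $x,y\in[n]$: $xy\in E$ if and only if $w_{\{x,y\}}$ has no $12$-match. An unlabeled graph is $12$-representable if some labeling of its vertices by $[n]$ (where $n$ is the number of vertices) gives a $12$-representable labeled graph. A double caterpillar is a tree $T$ in which all the vertices are within distance $2$ of a central path, i.e. there is a path in $T$ (possibly a single vertex) such that every vertex of $T$ is at distance at most $2$ from some vertex of this path. *)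

theory Defs
  imports "Graph_Theory.Graph_Theory"
begin

text \<open>
  A finite simple graph is a loop-free symmetric digraph without parallel arcs
  (locale \<^locale>\<open>pair_graph\<close>), in which each edge is the pair of its two
  orientations. There every edge already gives a directed cycle u, v, u of length 2; the
  cycles of the undirected graph are the directed cycles of length at least 3. The
  library's \<^const>\<open>tree\<close> forbids all directed cycles, hence all edges of a symmetric digraph.
\<close>

definition undirected_tree :: "'a pair_pre_digraph \<Rightarrow> bool" where
  "undirected_tree G \<longleftrightarrow>
     connected (with_proj G) \<and>
     \<not> (\<exists>p. pre_digraph.cycle (with_proj G) p \<and> 3 \<le> length p)"

definition graph_dist :: "'a pair_pre_digraph \<Rightarrow> 'a \<Rightarrow> 'a \<Rightarrow> ereal" where
  "graph_dist G u v = wf_digraph.\<mu> (with_proj G) (\<lambda>_. 1) u v"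

definition double_caterpillar :: "'a pair_pre_digraph \<Rightarrow> bool" where
  "double_caterpillar G \<longleftrightarrow>
     undirected_tree G \<and>
     (\<exists>p. vpath p (with_proj G) \<and>
          (\<forall>v \<in> pverts G. \<exists>u \<in> set p. graph_dist G v u \<le> 2))"

definition restrict_word :: "nat list \<Rightarrow> nat set \<Rightarrow> nat list" where
  "restrict_word w B = filter (\<lambda>x. x \<in> B) w"

definition has_12_match :: "nat list \<Rightarrow> bool" where
  "has_12_match w \<longleftrightarrow> (\<exists>i. Suc i < length w \<and> w ! i < w ! Suc i)"

text \<open>
  The labeled graph with vertex set \<open>{1..n}\<close> and (symmetric) adjacency relation \<open>E\<close>.
\<close>

definition labeled_12_representable :: "nat \<Rightarrow> nat rel \<Rightarrow> bool" where
  "labeled_12_representable n E \<longleftrightarrow>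
     (\<exists>w. set w = {1..n} \<and>
          (\<forall>x \<in> {1..n}. \<forall>y \<in> {1..n}. x \<noteq> y \<longrightarrow>
             ((x, y) \<in> E \<longleftrightarrow> \<not> has_12_match (restrict_word w {x, y}))))"

definition representable_12 :: "'a pair_pre_digraph \<Rightarrow> bool" where
  "representable_12 G \<longleftrightarrow>
     (\<exists>\<phi>. bij_betw \<phi> (pverts G) {1..card (pverts G)} \<and>
          labeled_12_representable (card (pverts G)) (map_prod \<phi> \<phi> ` parcs G))"

end

theory Submission
  imports Defs "HOL-Library.Product_Lexorder"
begin

text \<open>
  For labels \<open>x < y\<close>, the letters \<open>x\<close> and \<open>y\<close> avoid a 12-match exactly when no \<open>x\<close> stands before
  any \<open>y\<close> in the word. Everything below argues with this relation between positions.

  Necessity. Let two edges form an induced matching: they are disjoint and no edge joins one to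
  the other. Then the intervals spanned by their labels are disjoint. Otherwise the edges are
  \<open>d1 < u1\<close> and \<open>d2 < u2\<close> with \<open>d1 < u2\<close> and \<open>d2 < u1\<close>; the two non-edges put some \<open>d1\<close> before some
  \<open>u2\<close> and some \<open>d2\<close> before some \<open>u1\<close>, while the edges put each \<open>u2\<close> before each \<open>d2\<close> and each
  \<open>u1\<close> before each \<open>d1\<close>, which is circular (\<open>separated_edges\<close>). Now take the spider with three legs
  of length three. The intervals of the outermost edges of the legs are disjoint, so one of them
  lies between the other two. The route from one of these to the other through the centre uses only
  edges that form an induced matching with the middle one. Consecutive edges share a vertex, so the
  route never changes sides, a contradiction (\<open>separates_edges_imp_not_spider\<close>). Finally, in a tree
  with a vertex at distance three from a longest path, the path extends at least three steps to
  either side of the point of attachment, which gives such a spider (\<open>longest_path_covers\<close>).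

  Sufficiency. Let a graph be bipartite with classes \<open>D\<close> and \<open>U\<close>. A word that lists \<open>U\<close> in
  increasing order, then all vertices in some order, then \<open>D\<close> in increasing order has a 12-match
  for every pair of labels except possibly \<open>d < u\<close> with \<open>d\<close> in \<open>D\<close> and \<open>u\<close> in \<open>U\<close>, and there the
  order in the middle decides. So the graph is representable as soon as there are two linear
  orders, one for the labels and one for the middle of the word, such that \<open>d\<close> and \<open>u\<close> are
  adjacent iff \<open>d\<close> precedes \<open>u\<close> in the first and follows it in the second
  (\<open>two_orders_representable\<close>). For a double caterpillar these orders are explicit
  (\<open>covered_path_two_orders\<close>): they zigzag along the path, and all that hangs from one path vertex
  is inserted as a block into a suitable gap.

  Adjacency is kept manageable by rooting the tree at an end of the path, so that edges are exactly
  the pairs of a vertex and its parent (\<open>tree_rooted_at\<close>).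
\<close>

section \<open>12-matches and the order of letters\<close>

fun occurs_before :: "'b list \<Rightarrow> 'b \<Rightarrow> 'b \<Rightarrow> bool" where
  "occurs_before [] x y = False"
| "occurs_before (z # zs) x y = (z = x \<and> y \<in> set zs \<or> occurs_before zs x y)"

lemma occurs_before_append:
  "occurs_before (l1 @ l2) x y \<longleftrightarrow>
     occurs_before l1 x y \<or> occurs_before l2 x y \<or> x \<in> set l1 \<and> y \<in> set l2"
  by (induction l1) auto

lemma occurs_before_in_set: "occurs_before w x y \<Longrightarrow> x \<in> set w \<and> y \<in> set w"
  by (induction w) auto

lemma occurs_before_nth:
  "occurs_before w x y \<longleftrightarrow> (\<exists>i j. i < j \<and> j < length w \<and> w ! i = x \<and> w ! j = y)"
proof
  show "occurs_before w x y \<Longrightarrow> \<exists>i j. i < j \<and> j < length w \<and> w ! i = x \<and> w ! j = y"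
  proof (induction w)
    case (Cons z zs)
    show ?case
    proof (cases "z = x \<and> y \<in> set zs")
      case True
      then obtain j where "j < length zs" "zs ! j = y" by (auto simp: in_set_conv_nth)
      then show ?thesis using True by (intro exI[of _ 0] exI[of _ "Suc j"]) auto
    next
      case False
      then obtain i j where "i < j \<and> j < length zs \<and> zs ! i = x \<and> zs ! j = y"
        using Cons by auto
      then show ?thesis by (intro exI[of _ "Suc i"] exI[of _ "Suc j"]) auto
    qed
  qed simp
next
  assume "\<exists>i j. i < j \<and> j < length w \<and> w ! i = x \<and> w ! j = y"
  then obtain i j where ij: "i < j" "j < length w" "w ! i = x" "w ! j = y" by blast
  have "w = take j w @ drop j w" by simp
  moreover have "x \<in> set (take j w)" using ij by (auto simp: in_set_conv_nth)
  moreover have "y \<in> set (drop j w)" using ij by (auto simp: in_set_conv_nth intro!: exI[of _ 0])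
  ultimately show "occurs_before w x y" by (metis occurs_before_append)
qed

lemma occurs_before_map:
  assumes "inj_on \<phi> S" "set l \<subseteq> S" "a \<in> S" "b \<in> S"
  shows "occurs_before (map \<phi> l) (\<phi> a) (\<phi> b) \<longleftrightarrow> occurs_before l a b"
  using assms(2) by (induction l) (use assms in \<open>auto simp: inj_on_eq_iff inj_on_image_mem_iff\<close>)

lemma occurs_before_sorted:
  fixes F :: "'b \<Rightarrow> 'k::linorder"
  assumes "sorted (map F l)" "a \<in> set l" "b \<in> set l" "F a \<noteq> F b"
  shows "occurs_before l a b \<longleftrightarrow> F a < F b"
  using assms by (induction l) (auto dest: occurs_before_in_set)

lemma has_12_match_iff_occurs_before:
  assumes "x < y"
  shows "has_12_match (restrict_word w {x, y}) \<longleftrightarrow> occurs_before w x y"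
proof -
  have match: "has_12_match l \<longleftrightarrow> \<not> sorted_wrt (\<ge>) l" for l
    by (subst sorted_wrt_iff_nth_Suc_transp) (auto simp: has_12_match_def not_le)
  have "sorted_wrt (\<ge>) (restrict_word w {x, y}) \<longleftrightarrow> \<not> occurs_before w x y"
    using assms by (induction w) (auto simp: restrict_word_def)
  then show ?thesis by (simp add: match)
qed

lemma labeled_12_representable_iff:
  assumes "sym E"
  shows "labeled_12_representable n E \<longleftrightarrow>
    (\<exists>w. set w = {1..n} \<and> (\<forall>x \<in> {1..n}. \<forall>y \<in> {1..n}. x < y \<longrightarrow>
       ((x, y) \<in> E \<longleftrightarrow> \<not> occurs_before w x y)))" (is "_ \<longleftrightarrow> (\<exists>w. _ \<and> ?R w)")
proof -
  have "(\<forall>x \<in> {1..n}. \<forall>y \<in> {1..n}. x \<noteq> y \<longrightarrow>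
             ((x, y) \<in> E \<longleftrightarrow> \<not> has_12_match (restrict_word w {x, y}))) \<longleftrightarrow> ?R w" (is "?L w \<longleftrightarrow> _") for w
  proof
    assume "?L w" then show "?R w" by (auto simp: has_12_match_iff_occurs_before)
  next
    assume R: "?R w"
    show "?L w"
    proof (intro ballI impI)
      fix x y assume xy: "x \<in> {1..n}" "y \<in> {1..n}" "x \<noteq> y"
      have eq: "(y, x) \<in> E \<longleftrightarrow> (x, y) \<in> E" using assms by (meson symD)
      show "(x, y) \<in> E \<longleftrightarrow> \<not> has_12_match (restrict_word w {x, y})"
        using xy R has_12_match_iff_occurs_before[of x y w] has_12_match_iff_occurs_before[of y x w] eq
        by (cases x y rule: linorder_cases) (auto simp: insert_commute)
    qed
  qed
  then show ?thesis by (simp add: labeled_12_representable_def)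
qed

section \<open>Induced matchings and spiders\<close>

text \<open>
  After sorting the ends of both edges, overlapping intervals would give the circular order of
  positions \<open>d1\<close>, \<open>u2\<close>, \<open>d2\<close>, \<open>u1\<close>, \<open>d1\<close>.
\<close>

lemma separated_edges:
  fixes w :: "nat list"
  assumes rep: "\<And>x y. x \<in> {1..n} \<Longrightarrow> y \<in> {1..n} \<Longrightarrow> x < y \<Longrightarrow> (x, y) \<in> E \<longleftrightarrow> \<not> occurs_before w x y"
    and w: "set w = {1..n}" and "sym E"
    and V: "{x, y, z, t} \<subseteq> {1..n}"
    and edges: "(x, y) \<in> E" "(z, t) \<in> E" "x \<noteq> y" "z \<noteq> t"
    and cross: "{x, y} \<inter> {z, t} = {}" "E \<inter> {x, y} \<times> {z, t} = {}"
  shows "max x y < min z t \<or> max z t < min x y"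
proof -
  have key: "u1 < d2 \<or> u2 < d1"
    if A: "d1 < u1" "d2 < u2" "{d1, u1, d2, u2} \<subseteq> {1..n}" "(d1, u1) \<in> E" "(d2, u2) \<in> E"
       "(d1, u2) \<notin> E" "(d2, u1) \<notin> E" "u1 \<noteq> d2" "u2 \<noteq> d1" for d1 u1 d2 u2
  proof (rule ccontr)
    assume "\<not> ?thesis"
    then have lt: "d2 < u1" "d1 < u2" using A(8,9) by linarith+
    have "occurs_before w d1 u2" "occurs_before w d2 u1"
      using rep[of d1 u2] rep[of d2 u1] lt A by auto
    then obtain i j k l where ij: "i < j" "j < length w" "w ! i = d1" "w ! j = u2"
      and kl: "k < l" "l < length w" "w ! k = d2" "w ! l = u1"
      unfolding occurs_before_nth by blast
    have "\<not> i < l" using rep[of d1 u1] A ij kl by (auto simp: occurs_before_nth)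
    moreover have "\<not> k < j" using rep[of d2 u2] A ij kl by (auto simp: occurs_before_nth)
    ultimately show False using ij kl by simp
  qed
  have s: "(b, a) \<in> E \<longleftrightarrow> (a, b) \<in> E" for a b using \<open>sym E\<close> by (meson symD)
  show ?thesis
    using key[of "min x y" "max x y" "min z t" "max z t"] V edges cross s
    by (auto simp: min_def max_def split: if_splits)
qed

text \<open>
  The legs of the spider are \<open>c, a i, b i, e i\<close> for \<open>i < 3\<close>. The second part says that the outermost
  edge of each leg forms an induced matching with every edge of the other two legs.
\<close>

definition spider :: "'a rel \<Rightarrow> 'a \<Rightarrow> (nat \<Rightarrow> 'a) \<Rightarrow> (nat \<Rightarrow> 'a) \<Rightarrow> (nat \<Rightarrow> 'a) \<Rightarrow> bool" where
  "spider E c a b e \<longleftrightarrow>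
     (\<forall>i<3. (c, a i) \<in> E \<and> (a i, b i) \<in> E \<and> (b i, e i) \<in> E) \<and>
     (\<forall>i<3. \<forall>j<3. i \<noteq> j \<longrightarrow> {c, a j, b j, e j} \<inter> {b i, e i} = {} \<and>
        E \<inter> {c, a j, b j, e j} \<times> {b i, e i} = {})"

definition separates_edges :: "('a \<Rightarrow> nat) \<Rightarrow> 'a rel \<Rightarrow> bool" where
  "separates_edges \<phi> E \<longleftrightarrow>
     (\<forall>x y z t. (x, y) \<in> E \<longrightarrow> (z, t) \<in> E \<longrightarrow> {x, y} \<inter> {z, t} = {} \<longrightarrow> E \<inter> {x, y} \<times> {z, t} = {} \<longrightarrow>
        max (\<phi> x) (\<phi> y) < min (\<phi> z) (\<phi> t) \<or> max (\<phi> z) (\<phi> t) < min (\<phi> x) (\<phi> y))"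

text \<open>
  The outermost edge of leg \<open>i\<close> splits the remaining labels into those below and those above its
  interval. Walking along the legs \<open>j \<noteq> i\<close> shows that their outer ends are on the same side as the
  centre. But of three disjoint intervals one has the other two on different sides.
\<close>

lemma separates_edges_imp_not_spider:
  assumes "separates_edges \<phi> E"
  shows "\<not> spider E c a b e"
proof
  assume spider: "spider E c a b e"
  note sep = assms[unfolded separates_edges_def, rule_format]
  have legs: "(c, a i) \<in> E" "(a i, b i) \<in> E" "(b i, e i) \<in> E" if "i < 3" for i
    using spider that by (auto simp: spider_def)
  have disj: "{c, a j, b j, e j} \<inter> {b i, e i} = {}"
    and indep: "E \<inter> {c, a j, b j, e j} \<times> {b i, e i} = {}" if "i < 3" "j < 3" "i \<noteq> j" for i j
    using spider that unfolding spider_def by blast+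
  define m where "m i = min (\<phi> (b i)) (\<phi> (e i))" for i
  have same: "\<phi> (b j) < m i \<longleftrightarrow> \<phi> c < m i" if "i < 3" "j < 3" "i \<noteq> j" for i j
  proof -
    have "\<phi> (b j) < m i \<longleftrightarrow> \<phi> (a j) < m i"
      using sep[of "a j" "b j" "b i" "e i"] legs that disj[OF that] indep[OF that]
      by (auto simp: m_def)
    moreover have "\<phi> (a j) < m i \<longleftrightarrow> \<phi> c < m i"
      using sep[of c "a j" "b i" "e i"] legs that disj[OF that] indep[OF that]
      by (auto simp: m_def)
    ultimately show ?thesis by simp
  qed
  have anti: "\<phi> (b j) < m i \<longleftrightarrow> \<not> \<phi> (b i) < m j" if "i < 3" "j < 3" "i \<noteq> j" for i j
    using sep[of "b j" "e j" "b i" "e i"] legs that disj[OF that] indep[OF that]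
    by (auto simp: m_def)
  show False
    using same[of 0 1] same[of 0 2] same[of 1 0] same[of 1 2] same[of 2 0] same[of 2 1]
      anti[of 0 1] anti[of 0 2] anti[of 1 2] by auto
qed

lemma sym_map_prod: "sym E \<Longrightarrow> sym (map_prod \<phi> \<phi> ` E)"
  by (force simp: sym_def)

lemma map_prod_image_iff:
  assumes "inj_on \<phi> V" "E \<subseteq> V \<times> V" "a \<in> V" "b \<in> V"
  shows "(\<phi> a, \<phi> b) \<in> map_prod \<phi> \<phi> ` E \<longleftrightarrow> (a, b) \<in> E"
proof
  assume "(\<phi> a, \<phi> b) \<in> map_prod \<phi> \<phi> ` E"
  then obtain a' b' where *: "(a', b') \<in> E" "\<phi> a = \<phi> a'" "\<phi> b = \<phi> b'" by auto
  then have "a = a'" "b = b'" using assms by (auto dest: inj_onD)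
  then show "(a, b) \<in> E" using * by simp
qed force

lemma representable_12_separates_edges:
  assumes "pair_graph T" "representable_12 T"
  shows "\<exists>\<phi>. separates_edges \<phi> (parcs T)"
proof -
  interpret T: pair_graph T by fact
  define n where "n = card (pverts T)"
  obtain \<phi> where \<phi>: "bij_betw \<phi> (pverts T) {1..n}"
    and lab: "labeled_12_representable n (map_prod \<phi> \<phi> ` parcs T)" (is "labeled_12_representable n ?E")
    using assms(2) by (auto simp: representable_12_def n_def)
  have inj: "\<phi> a = \<phi> b \<longleftrightarrow> a = b" if "a \<in> pverts T" "b \<in> pverts T" for a b
    using \<phi> that by (auto simp: bij_betw_def inj_on_eq_iff)
  have rng: "\<phi> a \<in> {1..n}" if "a \<in> pverts T" for a
    using \<phi> that by (auto simp: bij_betw_def)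
  have E: "(\<phi> a, \<phi> b) \<in> ?E \<longleftrightarrow> (a, b) \<in> parcs T" if "a \<in> pverts T" "b \<in> pverts T" for a b
  proof (rule map_prod_image_iff[OF bij_betw_imp_inj_on[OF \<phi>] _ that])
    show "parcs T \<subseteq> pverts T \<times> pverts T" by (auto dest: T.wellformed')
  qed
  have "sym ?E" by (rule sym_map_prod) (auto intro: symI T.arcs_symmetric)
  then obtain w where w: "set w = {1..n}"
    and rep: "\<And>x y. x \<in> {1..n} \<Longrightarrow> y \<in> {1..n} \<Longrightarrow> x < y \<Longrightarrow> (x, y) \<in> ?E \<longleftrightarrow> \<not> occurs_before w x y"
    using lab unfolding labeled_12_representable_iff[OF \<open>sym ?E\<close>] by blast
  show ?thesis
    unfolding separates_edges_def
  proof (intro exI[of _ \<phi>] allI impI)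
    fix x y z t
    assume xy: "(x, y) \<in> parcs T" and zt: "(z, t) \<in> parcs T" and
      cross: "{x, y} \<inter> {z, t} = {}" "parcs T \<inter> {x, y} \<times> {z, t} = {}"
    have inV: "x \<in> pverts T" "y \<in> pverts T" "z \<in> pverts T" "t \<in> pverts T"
      using xy zt by (auto dest: T.wellformed')
    show "max (\<phi> x) (\<phi> y) < min (\<phi> z) (\<phi> t) \<or> max (\<phi> z) (\<phi> t) < min (\<phi> x) (\<phi> y)"
    proof (rule separated_edges[OF rep w \<open>sym ?E\<close>])
      show "{\<phi> x, \<phi> y, \<phi> z, \<phi> t} \<subseteq> {1..n}" using rng inV by blast
      show "(\<phi> x, \<phi> y) \<in> ?E" "(\<phi> z, \<phi> t) \<in> ?E" using xy zt by force+
      show "\<phi> x \<noteq> \<phi> y" "\<phi> z \<noteq> \<phi> t" using inj inV T.no_loops' xy zt by auto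
      show "{\<phi> x, \<phi> y} \<inter> {\<phi> z, \<phi> t} = {}" using cross(1) inj inV by auto
      show "?E \<inter> {\<phi> x, \<phi> y} \<times> {\<phi> z, \<phi> t} = {}"
      proof -
        have "(\<phi> a, \<phi> b) \<notin> ?E" if "a \<in> {x, y}" "b \<in> {z, t}" for a b
          using that cross(2) E[of a b] inV by auto
        then show ?thesis by auto
      qed
    qed
  qed
qed

section \<open>Representations from two linear orders\<close>

text \<open>
  \<open>F\<close> and \<open>G\<close> are sort keys rather than orders. Ties are allowed within a class, where any way of
  breaking them serves: two vertices of \<open>U\<close> appear in increasing order in the first part of the
  word, and two vertices outside \<open>U\<close> in the last part.
\<close>

lemma two_orders_representable:
  fixes T :: "'a pair_pre_digraph" and F G :: "'a \<Rightarrow> 'k::linorder"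
  assumes fin: "finite (pverts T)" and symT: "sym (parcs T)"
    and arcs: "parcs T \<subseteq> pverts T \<times> pverts T"
    and bip: "\<And>x y. (x, y) \<in> parcs T \<Longrightarrow> x \<in> U \<longleftrightarrow> y \<notin> U"
    and adj: "\<And>d u. d \<in> pverts T - U \<Longrightarrow> u \<in> pverts T \<inter> U \<Longrightarrow>
       (d, u) \<in> parcs T \<longleftrightarrow> F d < F u \<and> G u < G d"
    and noties: "\<And>d u. d \<in> pverts T - U \<Longrightarrow> u \<in> pverts T \<inter> U \<Longrightarrow> F d \<noteq> F u \<and> G d \<noteq> G u"
  shows "representable_12 T"
proof -
  define V where "V = pverts T"
  define n where "n = card V"
  obtain zs where zs: "set zs = V" "distinct zs" using fin finite_distinct_list V_def by blast
  define xs ys where "xs = sort_key F zs" and "ys = sort_key G zs"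
  have xs: "set xs = V" "distinct xs" "sorted (map F xs)" "length xs = n"
    using zs distinct_card[of zs] by (auto simp: xs_def n_def)
  have ys: "set ys = V" "sorted (map G ys)" using zs by (auto simp: ys_def)
  have bij: "bij_betw (\<lambda>i. xs ! (i - 1)) {1..n} V"
  proof -
    have "bij_betw (\<lambda>i. i - 1) {1..n} {..<n}"
      by (rule bij_betw_byWitness[where f' = Suc]) auto
    from bij_betw_trans[OF this bij_betw_nth[OF xs(2) refl xs(1)[symmetric], unfolded xs(4)]]
    show ?thesis by (simp add: o_def)
  qed
  define \<phi> where "\<phi> = the_inv_into {1..n} (\<lambda>i. xs ! (i - 1))"
  have bij': "bij_betw \<phi> V {1..n}" unfolding \<phi>_def by (rule bij_betw_the_inv_into[OF bij])
  then have inj: "inj_on \<phi> V" by (rule bij_betw_imp_inj_on)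
  have \<phi>_nth: "\<phi> (xs ! i) = Suc i" if "i < n" for i
    using the_inv_into_f_f[OF bij_betw_imp_inj_on[OF bij], of "Suc i"] that by (simp add: \<phi>_def)
  have sorted_\<phi>: "sorted (map \<phi> xs)"
    by (auto simp: sorted_iff_nth_mono xs \<phi>_nth)
  have F_mono: "F a \<le> F b" if "\<phi> a < \<phi> b" "a \<in> V" "b \<in> V" for a b
  proof -
    have "a \<in> set xs" "b \<in> set xs" using that xs by simp_all
    then obtain i j where "i < n" "j < n" "a = xs ! i" "b = xs ! j"
      unfolding in_set_conv_nth xs(4) by blast
    then show ?thesis using that xs(3,4) \<phi>_nth by (auto simp: sorted_iff_nth_mono)
  qed
  \<comment> \<open>The word is \<open>map \<phi> l\<close>. The outer parts provide the 12-matches of all non-edges other than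
    those where the smaller label is outside \<open>U\<close> and the larger one in \<open>U\<close>.\<close>
  define l where "l = filter (\<lambda>x. x \<in> U) xs @ ys @ filter (\<lambda>x. x \<notin> U) xs"
  have setl: "set l = V" using xs ys by (auto simp: l_def)
  have sub: "occurs_before (filter P xs) a b" if "\<phi> a < \<phi> b" "a \<in> V" "b \<in> V" "P a" "P b" for P a b
    using occurs_before_sorted[of \<phi> "filter P xs" a b] that xs sorted_\<phi>
    by (auto intro: sorted_filter)
  have rep: "(a, b) \<in> parcs T \<longleftrightarrow> \<not> occurs_before l a b"
    if ab: "a \<in> V" "b \<in> V" "\<phi> a < \<phi> b" for a b
  proof (cases "a \<in> U \<longleftrightarrow> b \<in> U")
    case True
    then have "occurs_before l a b"
      using sub[of a b "\<lambda>x. x \<in> U"] sub[of a b "\<lambda>x. x \<notin> U"] ab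
      by (auto simp: l_def occurs_before_append)
    then show ?thesis using True bip by blast
  next
    case False
    show ?thesis
    proof (cases "a \<in> U")
      case True
      then have "occurs_before l a b" using False ab xs by (auto simp: l_def occurs_before_append)
      moreover have "(b, a) \<notin> parcs T"
        using adj[of b a] True False ab F_mono[of a b] by (auto simp: V_def)
      ultimately show ?thesis using symT by (auto dest: symD)
    next
      case aD: False
      then have bU: "b \<in> U" using False by simp
      have "occurs_before l a b \<longleftrightarrow> occurs_before ys a b"
        using aD bU by (auto simp: l_def occurs_before_append dest: occurs_before_in_set)
      also have "\<dots> \<longleftrightarrow> G a < G b"
        using occurs_before_sorted[OF ys(2), of a b] ys(1) ab noties[of a b] aD bU V_def by auto
      finally show ?thesis
        using adj[of a b] noties[of a b] F_mono[of a b] ab aD bU by (auto simp: V_def)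
    qed
  qed
  let ?E = "map_prod \<phi> \<phi> ` parcs T"
  have E: "(\<phi> a, \<phi> b) \<in> ?E \<longleftrightarrow> (a, b) \<in> parcs T" if "a \<in> V" "b \<in> V" for a b
    using map_prod_image_iff[OF inj _ that, of "parcs T"] arcs by (simp add: V_def)
  have "sym ?E" by (rule sym_map_prod[OF symT])
  have imV: "\<phi> ` V = {1..n}" using bij' by (simp add: bij_betw_def)
  have "labeled_12_representable n ?E"
    unfolding labeled_12_representable_iff[OF \<open>sym ?E\<close>]
  proof (intro exI[of _ "map \<phi> l"] conjI ballI impI)
    show "set (map \<phi> l) = {1..n}" by (simp add: setl imV)
    fix x y assume "x \<in> {1..n}" "y \<in> {1..n}" "x < y"
    then obtain a b where "x = \<phi> a" "y = \<phi> b" "a \<in> V" "b \<in> V" unfolding imV[symmetric] by blast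
    then show "(x, y) \<in> ?E \<longleftrightarrow> \<not> occurs_before (map \<phi> l) x y"
      using rep[of a b] E[of a b] occurs_before_map[OF inj, of l a b] setl \<open>x < y\<close> by simp
  qed
  then show ?thesis using bij' by (auto simp: representable_12_def V_def n_def)
qed

section \<open>Rooted trees\<close>

text \<open>
  A path from \<open>y\<close> back to \<open>x\<close> that avoids the edge has length at least two, so together with the
  edge it is a cycle of length at least three.
\<close>

lemma tree_edge_is_bridge:
  assumes "pair_graph T" "undirected_tree T" "(x, y) \<in> parcs T"
  shows "(y, x) \<notin> (parcs T - {(x, y), (y, x)})\<^sup>*"
proof
  assume yx: "(y, x) \<in> (parcs T - {(x, y), (y, x)})\<^sup>*"
  interpret T: pair_graph T by fact
  define H where "H = \<lparr>pverts = pverts T, parcs = parcs T - {(x, y), (y, x)}\<rparr>"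
  have H: "pverts H = pverts T" "parcs H = parcs T - {(x, y), (y, x)}" by (simp_all add: H_def)
  interpret H: pair_wf_digraph H
    by unfold_locales (auto simp: H T.arc_fst_in_verts T.arc_snd_in_verts dest: T.wellformed')
  have vs: "x \<in> pverts T" "y \<in> pverts T" "x \<noteq> y" using assms(3) T.wellformed' T.no_loops' by auto
  have "y \<rightarrow>\<^sup>*\<^bsub>with_proj H\<^esub> x"
    using yx vs H.reachable_conv[of y x] by (simp add: H)
  then obtain p where p: "H.apath y p x" using H.reachable_apath by blast
  then have pH: "H.awalk y p x" and d: "distinct (pawalk_verts y p)"
    by (auto simp: H.apath_def)
  have "T.awalk y p x"
    using pH by (auto simp: H.awalk_def T.awalk_def H)
  then have "T.awalk x ((x, y) # p) x"
    using assms(3) vs by (auto simp: T.awalk_Cons_iff)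
  then have cyc: "T.cycle ((x, y) # p)"
    unfolding T.cycle_def using d by (intro exI[of _ x]) auto
  have "2 \<le> length p"
  proof (rule ccontr)
    assume "\<not> ?thesis"
    then have "p = [] \<or> (\<exists>e. p = [e])" by (cases p; cases "tl p") auto
    then show False using pH vs by (auto simp: H.awalk_simps H)
  qed
  then show False using cyc assms(2) by (auto simp: undirected_tree_def)
qed


text \<open>
  The height \<open>h\<close> is the distance from the root. The value of \<open>par\<close> at the root is arbitrary, hence
  the side conditions on \<open>r\<close>.
\<close>

locale rooted_tree =
  fixes T :: "'a pair_pre_digraph" and r :: 'a and par :: "'a \<Rightarrow> 'a" and h :: "'a \<Rightarrow> nat"
  assumes fin: "finite (pverts T)"
    and root: "r \<in> pverts T" "h r = 0"
    and par: "v \<in> pverts T \<Longrightarrow> v \<noteq> r \<Longrightarrow> par v \<in> pverts T"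
      "v \<in> pverts T \<Longrightarrow> v \<noteq> r \<Longrightarrow> h v = Suc (h (par v))"
    and adj: "(x, y) \<in> parcs T \<longleftrightarrow>
      x \<in> pverts T \<and> y \<in> pverts T \<and> (x \<noteq> r \<and> y = par x \<or> y \<noteq> r \<and> x = par y)"

text \<open>
  The parent of a vertex is some neighbour that is closer to the root. An edge that does not join a
  vertex to its parent could be removed without disconnecting either end from the root, as the
  chains of parents remain; but every edge is a bridge.
\<close>

lemma tree_rooted_at:
  assumes "pair_graph T" "undirected_tree T" "r \<in> pverts T"
  shows "\<exists>par h. rooted_tree T r par h"
proof -
  interpret T: pair_graph T by fact
  let ?E = "parcs T"
  have conn: "(r, v) \<in> ?E\<^sup>*" if "v \<in> pverts T" for v
  proof -
    have "strongly_connected (with_proj T)"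
      using assms(2) T.symmetric_connected_imp_strongly_connected T.pair_sym_arcs
      by (simp add: undirected_tree_def)
    then show ?thesis using that assms(3)
      by (auto simp: strongly_connected_def T.reachable_conv)
  qed
  define h where "h v = (LEAST n. (r, v) \<in> ?E ^^ n)" for v
  have h_le: "h v \<le> n" if "(r, v) \<in> ?E ^^ n" for v n
    unfolding h_def using that by (rule Least_le)
  have h_walk: "(r, v) \<in> ?E ^^ h v" if "v \<in> pverts T" for v
    unfolding h_def using conn[OF that] by (metis LeastI rtrancl_power)
  have h_r: "h r = 0" using h_le[of r 0] by simp
  have ex: "\<exists>u. (u, v) \<in> ?E \<and> h v = Suc (h u)" if v: "v \<in> pverts T" "v \<noteq> r" for v
  proof -
    obtain m where m: "h v = Suc m" using h_walk[OF v(1)] v(2) by (cases "h v") auto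
    then obtain u where u: "(r, u) \<in> ?E ^^ m" "(u, v) \<in> ?E" using h_walk[OF v(1)] by auto
    have "(r, u) \<in> ?E ^^ h u" using u(2) by (intro h_walk) (auto dest: T.wellformed')
    then have "(r, v) \<in> ?E ^^ Suc (h u)" using u(2) by auto
    from h_le[OF this] h_le[OF u(1)] m u(2) show ?thesis by auto
  qed
  define par where "par v = (SOME u. (u, v) \<in> ?E \<and> h v = Suc (h u))" for v
  have par: "(par v, v) \<in> ?E" "h v = Suc (h (par v))" if "v \<in> pverts T" "v \<noteq> r" for v
    using someI_ex[OF ex[OF that]] by (auto simp: par_def)
  have par_edge: "x \<noteq> r \<and> y = par x \<or> y \<noteq> r \<and> x = par y" if xy: "(x, y) \<in> ?E" for x y
  proof (rule ccontr)
    assume neg: "\<not> ?thesis"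
    let ?E' = "?E - {(x, y), (y, x)}"
    have "(v, r) \<in> ?E'\<^sup>* \<and> (r, v) \<in> ?E'\<^sup>*" if "v \<in> pverts T" for v
      using that
    proof (induction "h v" arbitrary: v)
      case 0
      then show ?case using par(2)[of v] by (cases "v = r") auto
    next
      case (Suc n)
      then have "v \<noteq> r" using h_r by auto
      note p = par[OF Suc.prems this]
      have "par v \<in> pverts T" using p(1) by (auto dest: T.wellformed')
      then have IH: "(par v, r) \<in> ?E'\<^sup>*" "(r, par v) \<in> ?E'\<^sup>*" using Suc p by auto
      have "(par v, v) \<in> ?E'" "(v, par v) \<in> ?E'"
        using p(1) T.arcs_symmetric[OF p(1)] neg \<open>v \<noteq> r\<close> by auto
      then show ?case using IH by (meson converse_rtrancl_into_rtrancl rtrancl_into_rtrancl)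
    qed
    then have "(y, x) \<in> ?E'\<^sup>*" using xy by (meson T.wellformed' rtrancl_trans)
    with tree_edge_is_bridge[OF assms(1,2) xy] show False by blast
  qed
  have "rooted_tree T r par h"
  proof
    show "finite (pverts T)" by (rule T.pair_finite_verts)
    show "(x, y) \<in> parcs T \<longleftrightarrow>
      x \<in> pverts T \<and> y \<in> pverts T \<and> (x \<noteq> r \<and> y = par x \<or> y \<noteq> r \<and> x = par y)" for x y
      using par_edge par(1) T.arcs_symmetric T.wellformed' by blast
  qed (use assms(3) h_r par T.wellformed' in auto)
  then show ?thesis by blast
qed

lemma graph_dist_le_2_iff:
  assumes "pair_graph T" "v \<in> pverts T"
  shows "graph_dist T v u \<le> 2 \<longleftrightarrow>
    v = u \<or> (v, u) \<in> parcs T \<or> (\<exists>q. (v, q) \<in> parcs T \<and> (q, u) \<in> parcs T)"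
proof -
  interpret T: pair_graph T by fact
  have cost: "T.awalk_cost (\<lambda>_. 1) p = real (length p)" for p
    by (simp add: T.awalk_cost_def sum_list_triv)
  have "graph_dist T v u \<le> 2 \<longleftrightarrow> (\<exists>p. T.awalk v p u \<and> length p \<le> 2)"
  proof
    assume "graph_dist T v u \<le> 2"
    also have "(2::ereal) < 3" by simp
    finally obtain p where "T.awalk v p u" "ereal (real (length p)) < 3"
      unfolding graph_dist_def T.\<mu>_def INF_less_iff cost by auto
    then show "\<exists>p. T.awalk v p u \<and> length p \<le> 2"
      by (intro exI[of _ p]) auto
  next
    assume "\<exists>p. T.awalk v p u \<and> length p \<le> 2"
    then obtain p where p: "T.awalk v p u" "length p \<le> 2" by blast
    have "graph_dist T v u \<le> ereal (real (length p))"
      using T.min_cost_le_walk_cost[OF p(1), of "\<lambda>_. 1"] by (simp add: graph_dist_def cost)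
    also have "\<dots> \<le> 2" using p(2) by auto
    finally show "graph_dist T v u \<le> 2" .
  qed
  also have "\<dots> \<longleftrightarrow> v = u \<or> (v, u) \<in> parcs T \<or> (\<exists>q. (v, q) \<in> parcs T \<and> (q, u) \<in> parcs T)"
    (is "?L \<longleftrightarrow> ?R")
  proof
    assume ?L
    then obtain p where p: "T.awalk v p u" "length p \<le> 2" by blast
    then consider "p = []" | e where "p = [e]" | e f where "p = [e, f]"
      by (cases p; cases "tl p") (auto simp: neq_Nil_conv)
    then show ?R using p(1) by cases (auto simp: T.awalk_simps)
  next
    assume ?R
    then have "T.awalk v [] u \<or> T.awalk v [(v, u)] u \<or> (\<exists>q. T.awalk v [(v, q), (q, u)] u)"
      using assms(2) by (auto simp: T.awalk_simps dest: T.wellformed')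
    then show ?L by (elim disjE exE) (auto intro!: exI)
  qed
  finally show ?thesis .
qed

section \<open>Paths that start at the root\<close>

lemma vpath_iff_successively:
  "vpath p (with_proj T) \<longleftrightarrow>
     p \<noteq> [] \<and> set p \<subseteq> pverts T \<and> successively (\<lambda>x y. (x, y) \<in> parcs T) p \<and> distinct p"
proof -
  have "set (vwalk_arcs p) \<subseteq> parcs T \<longleftrightarrow> successively (\<lambda>x y. (x, y) \<in> parcs T) p"
    by (induction p rule: vwalk_arcs.induct) auto
  then show ?thesis by (auto simp: vpath_def vwalk_def)
qed

locale rooted_path = rooted_tree T r par h for T :: "'a pair_pre_digraph" and r par h +
  fixes p :: "'a list"
  assumes path: "vpath p (with_proj T)" and hd_path: "hd p = r"
begin

lemma path_simps: "p \<noteq> []" "distinct p" "p ! 0 = r"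
  "v \<in> set p \<Longrightarrow> v \<in> pverts T" "r \<in> set p"
  using path hd_path by (auto simp: vpath_iff_successively hd_conv_nth[symmetric])

text \<open>
  The first edge leaves the root, so it goes down. Each later vertex has already its predecessor on
  the path as parent, and so its successor, a different neighbour, must be a child.
\<close>

lemma path_nth:
  assumes "Suc i < length p"
  shows "par (p ! Suc i) = p ! i" "p ! Suc i \<noteq> r"
proof -
  have d: "p ! Suc k \<noteq> r" if "Suc k < length p" for k
    using that path_simps(1-3) by (metis nth_eq_iff_index_eq length_greater_0_conv nat.simps(3))
  have e: "(p ! k, p ! Suc k) \<in> parcs T" if "Suc k < length p" for k
    using path that by (simp add: vpath_iff_successively successively_conv_nth)
  show "par (p ! Suc i) = p ! i" using assms
  proof (induction i)
    case 0 then show ?case using e[of 0] path_simps(3) by (auto simp: adj)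
  next
    case (Suc i)
    then have "p ! i \<noteq> p ! Suc (Suc i)" using path_simps(2) by (simp add: nth_eq_iff_index_eq)
    then show ?case using e[of "Suc i"] Suc by (auto simp: adj)
  qed
  show "p ! Suc i \<noteq> r" using d assms .
qed

lemma h_path_nth: "i < length p \<Longrightarrow> h (p ! i) = i"
proof (induction i)
  case 0 then show ?case using path_simps root by simp
next
  case (Suc i) then show ?case using path_nth[of i] par(2)[of "p ! Suc i"] path_simps(4) by auto
qed

lemma par_in_path: "v \<in> set p \<Longrightarrow> v \<noteq> r \<Longrightarrow> par v \<in> set p"
  by (metis in_set_conv_nth path_nth(1) path_simps(3) not0_implies_Suc Suc_lessD)

lemma h_inj_path: "v \<in> set p \<Longrightarrow> u \<in> set p \<Longrightarrow> h v = h u \<longleftrightarrow> v = u"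
  by (metis in_set_conv_nth h_path_nth)

text \<open>
  Otherwise some chain \<open>x, y, z\<close> of vertices off the path climbs to a path vertex \<open>p ! j\<close>. Replacing
  the part of the path on either side of \<open>p ! j\<close> by this chain gives another path, so both parts
  have at least three vertices. They form, with the chain, a spider centred at \<open>p ! j\<close>.
\<close>

lemma longest_path_covers:
  assumes longest: "\<forall>q. vpath q (with_proj T) \<longrightarrow> length q \<le> length p"
    and no_spider: "\<And>c a b e. \<not> spider (parcs T) c a b e"
    and "v \<in> pverts T"
  shows "v \<in> set p \<or> par v \<in> set p \<or> par (par v) \<in> set p"
  using \<open>v \<in> pverts T\<close>
proof (induction "h v" arbitrary: v rule: less_induct)
  case less
  show ?case
  proof (rule ccontr)
    assume neg: "\<not> ?thesis"
    define x y z where "x = v" and "y = par x" and "z = par y"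
    have nin: "x \<notin> set p" "y \<notin> set p" "z \<notin> set p" using neg by (auto simp: x_def y_def z_def)
    then have nr: "x \<noteq> r" "y \<noteq> r" "z \<noteq> r" using path_simps(5) by auto
    have inV: "x \<in> pverts T" "y \<in> pverts T" "z \<in> pverts T"
      using less.prems nr par(1) by (auto simp: x_def y_def z_def)
    have hs: "h x = Suc (h y)" "h y = Suc (h z)" "h z = Suc (h (par z))"
      using inV nr par(2) by (auto simp: x_def y_def z_def)
    have "par z \<in> set p"
      using less.hyps[of y] hs inV nin by (auto simp: x_def y_def z_def)
    then obtain j where j: "j < length p" "p ! j = par z" by (metis in_set_conv_nth)
    have edges: "(x, y) \<in> parcs T" "(y, z) \<in> parcs T" "(z, p ! j) \<in> parcs T"
      "(y, x) \<in> parcs T" "(z, y) \<in> parcs T" "(p ! j, z) \<in> parcs T"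
      using inV nr j path_simps(4) \<open>par z \<in> set p\<close> by (auto simp: adj x_def y_def z_def)
    have dist: "x \<noteq> y" "x \<noteq> z" "y \<noteq> z" using hs by auto
    have p: "set p \<subseteq> pverts T" "distinct p" "successively (\<lambda>x y. (x, y) \<in> parcs T) p"
      using path by (auto simp: vpath_iff_successively)
    have "successively (\<lambda>x y. (x, y) \<in> parcs T) (take i p) \<and>
        successively (\<lambda>x y. (x, y) \<in> parcs T) (drop i p)" for i
      using p(3) successively_append_iff[of _ "take i p" "drop i p"] by simp
    note p = p this
    have "vpath ([x, y, z] @ drop j p) (with_proj T)"
      using edges dist inV nin p j
      by (auto simp: vpath_iff_successively hd_drop_conv_nth successively_Cons
          dest: in_set_dropD)
    from longest[rule_format, OF this] j have j3: "3 \<le> j" by simp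
    have "last (take (Suc j) p) = p ! j" using j by (simp add: take_Suc_conv_app_nth)
    then have "vpath (take (Suc j) p @ [z, y, x]) (with_proj T)"
      using edges dist inV nin p j
      by (auto simp: vpath_iff_successively successively_append_iff
          dest: in_set_takeD)
    from longest[rule_format, OF this] j have j4: "j + 4 \<le> length p" by simp
    \<comment> \<open>\<open>P 0, \<dots>, P 6\<close> are the path vertices around the centre \<open>P 3\<close>.\<close>
    define k where "k = j - 3"
    define P where "P i = p ! (k + i)" for i
    have k: "k + 7 \<le> length p" "P 3 = par z" using j3 j4 j by (simp_all add: k_def P_def)
    have hP: "h (P i) = k + i" "P i \<in> set p" if "i < 7" for i
      using h_path_nth[of "k + i"] that k by (auto simp: P_def)
    have parP: "par (P (Suc i)) = P i" "P (Suc i) \<noteq> r" if "i < 6" for i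
      using path_nth[of "k + i"] that k by (auto simp: P_def)
    have eqP: "P i = P j \<longleftrightarrow> i = j" if "i < 7" "j < 7" for i j
      using hP(1)[OF that(1)] hP(1)[OF that(2)] by (metis add_left_imp_eq)
    have nP: "P i \<noteq> x" "P i \<noteq> y" "P i \<noteq> z" "x \<noteq> P i" "y \<noteq> P i" "z \<noteq> P i" if "i < 7" for i
      using hP(2)[OF that] nin by auto
    have parP': "par (P 1) = P 0" "par (P 2) = P 1" "par (P 3) = P 2" "par (P 4) = P 3"
      "par (P 5) = P 4" "par (P 6) = P 5" "par z = P 3" "par y = z" "par x = y"
      using parP(1)[of 0] parP(1)[of 1] parP(1)[of 2] parP(1)[of 3] parP(1)[of 4] parP(1)[of 5] k
      by (simp_all add: eval_nat_numeral x_def y_def z_def)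
    have rP: "P 1 \<noteq> r" "P 2 \<noteq> r" "P 3 \<noteq> r" "P 4 \<noteq> r" "P 5 \<noteq> r" "P 6 \<noteq> r"
      using parP(2)[of 0] parP(2)[of 1] parP(2)[of 2] parP(2)[of 3] parP(2)[of 4] parP(2)[of 5]
      by (simp_all add: eval_nat_numeral)
    have inP: "P i \<in> pverts T" if "i < 7" for i using hP(2)[OF that] path_simps(4) by blast
    \<comment> \<open>\<open>P 0\<close> may or may not be the root. If it is not, then its parent is a further path vertex.\<close>
    have par0: "P i \<noteq> par (P 0)" if "i < 7" "P 0 \<noteq> r" for i
      using par(2)[of "P 0"] inP[of 0] hP(1)[of 0] hP(1)[of i] that by auto
    have par0': "x \<noteq> par (P 0)" "y \<noteq> par (P 0)" "z \<noteq> par (P 0)" if "P 0 \<noteq> r"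
      using par_in_path[of "P 0"] hP(2)[of 0] that nin by auto
    note facts = adj eqP nP nP[symmetric] parP' rP inP par0 par0' par0[symmetric] par0'[symmetric] inV nr
      dist dist[symmetric]
    have "spider (parcs T) (P 3) (\<lambda>i. if i = 0 then P 2 else if i = 1 then P 4 else z)
        (\<lambda>i. if i = 0 then P 1 else if i = 1 then P 5 else y)
        (\<lambda>i. if i = 0 then P 0 else if i = 1 then P 6 else x)"
      unfolding spider_def
    proof (intro conjI[of "All _" "All _"] allI impI, goal_cases)
      case (1 i)
      then consider "i = 0" | "i = 1" | "i = 2" by linarith
      then show ?case by cases (simp_all add: facts del: One_nat_def)
    next
      case (2 i j)
      then consider "i = 0" "j = 1" | "i = 0" "j = 2" | "i = 1" "j = 0" | "i = 1" "j = 2"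
        | "i = 2" "j = 0" | "i = 2" "j = 1" by linarith
      then show ?case
        by cases (simp_all only: HOL.simp_thms if_True if_False one_neq_zero zero_neq_one
            numeral_eq_one_iff, auto simp: facts simp del: One_nat_def)
    qed
    then show False using no_spider by blast
  qed
qed

text \<open>
  Write \<open>p0, p1, \<dots>\<close> for the path and \<open>Hi\<close> for the block of all vertices off the path that hang from
  \<open>pi\<close>; the height of \<open>pi\<close> is \<open>i\<close>. The two orders arrange these as follows.

  \<^item> \<open>F\<close>: \<open>p0 H0 H1 p2 p1 H2 H3 p4 p3 H4 H5 p6 p5 \<dots>\<close>
  \<^item> \<open>G\<close>: \<open>H0 p1 p0 H1 H2 p3 p2 H3 H4 p5 p4 H5 \<dots>\<close>

  An even \<open>d\<close> and an odd \<open>u\<close> are to be adjacent iff \<open>d\<close> precedes \<open>u\<close> in \<open>F\<close> and follows it in \<open>G\<close>. Along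
  the path this singles out consecutive vertices. Among the vertices off the path, \<open>pi\<close> is related in
  this way only to those of opposite parity in its own block, and these are children of \<open>pi\<close>. Distinct blocks come
  in the same order in \<open>F\<close> and \<open>G\<close>, hence are not joined. A block consists of stars, each a child of
  \<open>pi\<close> with its own children. The stars of a block also come in the same order in \<open>F\<close> and \<open>G\<close>, while
  within a star \<open>F\<close> has the even vertices first and \<open>G\<close> the odd ones, which joins the centre to its
  leaves. This is a lexicographic comparison of three keys: place, star, parity.
\<close>

lemma covered_path_two_orders:
  assumes cover: "\<forall>v \<in> pverts T. v \<in> set p \<or> par v \<in> set p \<or> par (par v) \<in> set p"
  shows "\<exists>(F :: 'a \<Rightarrow> nat \<times> nat \<times> nat) (G :: 'a \<Rightarrow> nat \<times> nat \<times> nat). \<forall>d u.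
    d \<in> pverts T \<longrightarrow> u \<in> pverts T \<longrightarrow> even (h d) \<longrightarrow> odd (h u) \<longrightarrow>
    ((d, u) \<in> parcs T \<longleftrightarrow> F d < F u \<and> G u < G d) \<and> F d \<noteq> F u \<and> G d \<noteq> G u"
proof -
  obtain name :: "'a \<Rightarrow> nat" where name: "inj_on name (pverts T)"
    using finite_imp_inj_to_nat_seg[OF fin] by blast
  \<comment> \<open>For \<open>v\<close> off the path, \<open>star v\<close> is the centre of its star and \<open>k v\<close> the index of its block. On the
    path, \<open>k v\<close> is the index of \<open>v\<close>, and \<open>star v\<close> does not influence comparisons between vertices of
    opposite parity. The keys \<open>f\<close> and \<open>g\<close> number the places displayed above.\<close>
  define star where "star v = (if par v \<in> set p then v else par v)" for v
  define k where "k v = h (if v \<in> set p then v else par (star v))" for v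
  define f where "f v = 4 * (k v div 2) +
    (if v \<in> set p then (if even (k v) then 0 else 5) else (if even (k v) then 2 else 3))" for v
  define g where "g v = 4 * (k v div 2) +
    (if v \<in> set p then (if even (k v) then 2 else 1) else (if even (k v) then 0 else 3))" for v
  define F where "F v = (f v, name (star v), if even (h v) then 0 else 1::nat)" for v
  define G where "G v = (g v, name (star v), if even (h v) then 1 else 0::nat)" for v
  have on: "k v = h v" if "v \<in> set p" for v using that by (simp add: k_def)
  have off: "v \<noteq> r" "par (star v) \<in> set p" "star v \<notin> set p" "star v \<in> pverts T" "star v \<noteq> r"
    "h (star v) = Suc (k v)" "k v = h (par (star v))"
    "v = star v \<and> h v = Suc (k v) \<or> par v = star v \<and> par v \<notin> set p \<and> h v = Suc (Suc (k v))"
    if v: "v \<in> pverts T" "v \<notin> set p" for v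
  proof -
    show 1: "v \<noteq> r" using v path_simps by auto
    show 2: "par (star v) \<in> set p" using cover[rule_format, OF v(1)] v by (auto simp: star_def)
    show 3: "star v \<notin> set p" using v by (auto simp: star_def)
    then show 4: "star v \<noteq> r" using path_simps by auto
    show 5: "star v \<in> pverts T" using v 1 par(1) by (auto simp: star_def)
    show 6: "k v = h (par (star v))" using v by (simp add: k_def)
    show 7: "h (star v) = Suc (k v)" using par(2)[OF 5 4] 6 by simp
    show "v = star v \<and> h v = Suc (k v) \<or> par v = star v \<and> par v \<notin> set p \<and> h v = Suc (Suc (k v))"
      using par(2)[OF v(1) 1] 7 by (auto simp: star_def)
  qed
  have orders: "((d, u) \<in> parcs T \<longleftrightarrow> F d < F u \<and> G u < G d) \<and> F d \<noteq> F u \<and> G d \<noteq> G u"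
    if du: "d \<in> pverts T" "u \<in> pverts T" and parity: "even (h d)" "odd (h u)" for d u
  proof -
    have "F d \<noteq> F u" "G d \<noteq> G u" using parity by (auto simp: F_def G_def)
    \<comment> \<open>Adjacency in terms of \<open>h\<close>, \<open>k\<close> and \<open>star\<close>: both vertices on the path, one of them, or none.\<close>
    have pp: "(d, u) \<in> parcs T \<longleftrightarrow> h d = Suc (h u) \<or> h u = Suc (h d)" if "d \<in> set p" "u \<in> set p"
    proof -
      have "y \<noteq> r \<and> x = par y \<longleftrightarrow> h y = Suc (h x)" if "x \<in> set p" "y \<in> set p" for x y
      proof
        assume "h y = Suc (h x)"
        then have "y \<noteq> r" using root(2) by auto
        moreover from this have "h (par y) = h x"
          using par(2)[of y] path_simps(4) that \<open>h y = _\<close> by auto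
        ultimately show "y \<noteq> r \<and> x = par y" using h_inj_path[of "par y" x] par_in_path that by auto
      qed (use par(2)[of y] path_simps(4) that in auto)
      from this[of d u] this[of u d] that du show ?thesis by (auto simp: adj)
    qed
    have ph: "(x, y) \<in> parcs T \<longleftrightarrow> h y = Suc (k y) \<and> h x = k y"
      if "x \<in> set p" "y \<in> pverts T" "y \<notin> set p" for x y
    proof -
      have "(x, y) \<in> parcs T \<longleftrightarrow> x = par y"
        using that off(1)[of y] par_in_path path_simps(4) by (auto simp: adj)
      also have "\<dots> \<longleftrightarrow> h y = Suc (k y) \<and> x = par (star y)"
        using off[of y] that by auto
      also have "\<dots> \<longleftrightarrow> h y = Suc (k y) \<and> h x = k y"
        using off(2,7)[of y] that h_inj_path by auto
      finally show ?thesis .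
    qed
    have hh: "(d, u) \<in> parcs T \<longleftrightarrow> star d = star u" if "d \<notin> set p" "u \<notin> set p"
    proof
      assume "(d, u) \<in> parcs T"
      then consider "u = par d" | "d = par u" by (auto simp: adj)
      then show "star d = star u"
        by cases (use that off[of d] off[of u] du in \<open>auto simp: star_def\<close>)
    next
      assume eq: "star d = star u"
      then have "k d = k u" using off(7) du that by metis
      then show "(d, u) \<in> parcs T"
        using off(1,8)[of d] off(1,8)[of u] du that parity eq by (auto simp: adj)
    qed
    have "(d, u) \<in> parcs T \<longleftrightarrow> F d < F u \<and> G u < G d"
    proof (cases "d \<in> set p"; cases "u \<in> set p")
      assume A: "d \<in> set p" "u \<in> set p"
      obtain a b where "h d = 2 * a" "h u = 2 * b + 1" using parity by (metis evenE oddE)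
      then have "f d = 4 * a" "g d = 4 * a + 2" "f u = 4 * b + 5" "g u = 4 * b + 1"
        using A on by (simp_all add: f_def g_def)
      then show ?thesis
        using pp[OF A] \<open>h d = _\<close> \<open>h u = _\<close> by (simp add: F_def G_def) presburger
    next
      assume A: "d \<in> set p" "u \<notin> set p"
      obtain a where a: "h d = 2 * a" using parity by (metis evenE)
      then have fd: "f d = 4 * a" "g d = 4 * a + 2" using A on by (simp_all add: f_def g_def)
      show ?thesis
      proof (cases "even (k u)")
        case True
        then obtain b where b: "k u = 2 * b" by (metis evenE)
        then have "f u = 4 * b + 2" "g u = 4 * b" using A by (simp_all add: f_def g_def)
        moreover have "h u = Suc (k u)" using off(8)[OF du(2) A(2)] parity True by auto
        ultimately show ?thesis using fd a b ph[OF A(1) du(2) A(2)]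
          by (simp add: F_def G_def) presburger
      next
        case False
        then obtain b where b: "k u = 2 * b + 1" by (metis oddE)
        then have "f u = 4 * b + 3" "g u = 4 * b + 3" using A by (simp_all add: f_def g_def)
        moreover have "h u \<noteq> Suc (k u)" using parity False by auto
        ultimately show ?thesis using fd a b ph[OF A(1) du(2) A(2)]
          by (simp add: F_def G_def) presburger
      qed
    next
      assume A: "d \<notin> set p" "u \<in> set p"
      obtain b where b: "h u = 2 * b + 1" using parity by (metis oddE)
      then have fu: "f u = 4 * b + 5" "g u = 4 * b + 1" using A on by (simp_all add: f_def g_def)
      have ud: "(d, u) \<in> parcs T \<longleftrightarrow> (u, d) \<in> parcs T" by (auto simp: adj)
      show ?thesis
      proof (cases "even (k d)")
        case False
        then obtain a where a: "k d = 2 * a + 1" by (metis oddE)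
        then have "f d = 4 * a + 3" "g d = 4 * a + 3" using A by (simp_all add: f_def g_def)
        moreover have "h d = Suc (k d)" using off(8)[OF du(1) A(1)] parity False by auto
        ultimately show ?thesis using fu a b ph[OF A(2) du(1) A(1)] ud
          by (simp add: F_def G_def) presburger
      next
        case True
        then obtain a where a: "k d = 2 * a" by (metis evenE)
        then have "f d = 4 * a + 2" "g d = 4 * a" using A by (simp_all add: f_def g_def)
        moreover have "h d \<noteq> Suc (k d)" using parity True by auto
        ultimately show ?thesis using fu a b ph[OF A(2) du(1) A(1)] ud
          by (simp add: F_def G_def) presburger
      qed
    next
      assume A: "d \<notin> set p" "u \<notin> set p"
      have mono: "(f d < f u \<longleftrightarrow> k d < k u) \<and> (g u < g d \<longleftrightarrow> k u < k d) \<and>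
          (f d = f u \<longleftrightarrow> k d = k u) \<and> (g d = g u \<longleftrightarrow> k d = k u)"
      proof -
        have odd_less: "Suc (2 * a) < 2 * b \<longleftrightarrow> a < b" for a b :: nat by arith
        have block: "4 * (m div 2) + (if even m then s else 3) < 4 * (n div 2) + (if even n then s else 3)
            \<longleftrightarrow> m < n" if "s \<le> 2" for m n s :: nat
          using that by (cases "even m"; cases "even n"; elim evenE oddE)
            (auto simp: less_Suc_eq_le odd_less)
        have "f d < f u \<longleftrightarrow> k d < k u" "f u < f d \<longleftrightarrow> k u < k d"
          "g d < g u \<longleftrightarrow> k d < k u" "g u < g d \<longleftrightarrow> k u < k d"
          using A block[of 2] block[of 0] by (simp_all add: f_def g_def)
        then show ?thesis by (metis linorder_neqE_nat less_irrefl)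
      qed
      have "star d = star u \<longleftrightarrow> name (star d) = name (star u)"
        using off(4) A du name by (auto simp: inj_on_eq_iff)
      moreover have "star d = star u \<Longrightarrow> k d = k u" using off(7) du A by metis
      ultimately show ?thesis
        using hh[OF A] mono parity by (auto simp: F_def G_def)
    qed
    then show ?thesis using \<open>F d \<noteq> F u\<close> \<open>G d \<noteq> G u\<close> by simp
  qed
  show ?thesis
    by (rule exI[of _ F], rule exI[of _ G], intro allI impI, rule orders)
qed

end

section \<open>Representable trees\<close>

theorem theorem10:
  fixes T :: "'a pair_pre_digraph"
  assumes "pair_graph T"
    and "undirected_tree T"
  shows "representable_12 T \<longleftrightarrow> double_caterpillar T"
proof
  interpret T: pair_graph T by fact
  assume "representable_12 T"
  then obtain \<phi> where sep: "separates_edges \<phi> (parcs T)"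
    using representable_12_separates_edges[OF assms(1)] by blast
  have "pverts T \<noteq> {}"
    using assms(2) by (simp add: undirected_tree_def connected_conv)
  then obtain v0 where "v0 \<in> pverts T" by blast
  then have "vpath [v0] (with_proj T)" by (simp add: vpath_iff_successively)
  moreover have "length q < Suc (card (pverts T))" if "vpath q (with_proj T)" for q
  proof -
    have "card (set q) \<le> card (pverts T)"
      using that T.pair_finite_verts by (intro card_mono) (auto simp: vpath_iff_successively)
    then show ?thesis using that distinct_card[of q] by (simp add: vpath_iff_successively)
  qed
  ultimately obtain p where p: "vpath p (with_proj T)"
    and longest: "\<forall>q. vpath q (with_proj T) \<longrightarrow> length q \<le> length p"
    using ex_has_greatest_nat[of "\<lambda>q. vpath q (with_proj T)" "[v0]" length "Suc (card (pverts T))"]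
    by (auto intro: less_imp_le)
  then have "hd p \<in> pverts T" by (cases p) (auto simp: vpath_iff_successively)
  then obtain par h where "rooted_tree T (hd p) par h" using tree_rooted_at[OF assms] by blast
  then interpret rooted_path T "hd p" par h p
    using p by (auto simp: rooted_path_def rooted_path_axioms_def)
  note cover = longest_path_covers[OF longest separates_edges_imp_not_spider[OF sep]]
  have "\<exists>u \<in> set p. graph_dist T v u \<le> 2" if v: "v \<in> pverts T" for v
  proof -
    have step: "(x, par x) \<in> parcs T" if "x \<in> pverts T" "x \<notin> set p" for x
    proof -
      have "x \<noteq> hd p" using that path_simps(5) by metis
      then show ?thesis using that par(1)[of x] by (simp add: adj)
    qed
    consider "v \<in> set p" | "v \<notin> set p" "par v \<in> set p" | "v \<notin> set p" "par v \<notin> set p" "par (par v) \<in> set p"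
      using cover[OF v] by blast
    then show ?thesis
    proof cases
      case 1 then show ?thesis using graph_dist_le_2_iff[OF assms(1) v] by blast
    next
      case 2 then show ?thesis using graph_dist_le_2_iff[OF assms(1) v] step v by blast
    next
      case 3
      then have "(v, par v) \<in> parcs T" "(par v, par (par v)) \<in> parcs T"
        using step v T.wellformed' by blast+
      then show ?thesis using graph_dist_le_2_iff[OF assms(1) v] 3 by blast
    qed
  qed
  then show "double_caterpillar T" using assms(2) p by (auto simp: double_caterpillar_def)
next
  interpret T: pair_graph T by fact
  assume "double_caterpillar T"
  then obtain p where p: "vpath p (with_proj T)"
    and dist: "\<And>v. v \<in> pverts T \<Longrightarrow> \<exists>u \<in> set p. graph_dist T v u \<le> 2"
    by (auto simp: double_caterpillar_def)
  then have "hd p \<in> pverts T" by (cases p) (auto simp: vpath_iff_successively)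
  then obtain par h where "rooted_tree T (hd p) par h" using tree_rooted_at[OF assms] by blast
  then interpret rooted_path T "hd p" par h p
    using p by (auto simp: rooted_path_def rooted_path_axioms_def)
  have up: "par x = u" if "(x, u) \<in> parcs T" "u \<in> set p" "x \<notin> set p" for x u
    using that par_in_path[of u] unfolding adj by metis
  have "\<forall>v \<in> pverts T. v \<in> set p \<or> par v \<in> set p \<or> par (par v) \<in> set p"
  proof (rule ballI, rule ccontr)
    fix v assume v: "v \<in> pverts T" and neg: "\<not> (v \<in> set p \<or> par v \<in> set p \<or> par (par v) \<in> set p)"
    obtain u where u: "u \<in> set p" "graph_dist T v u \<le> 2" using dist[OF v] by blast
    then obtain q where q: "(v, q) \<in> parcs T" "(q, u) \<in> parcs T" "q \<notin> set p"
      using neg up u(1) unfolding graph_dist_le_2_iff[OF assms(1) v] by metis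
    then have "par q = u" using up u(1) by blast
    then show False using q(1) neg u(1) by (auto simp: adj)
  qed
  from covered_path_two_orders[OF this] obtain F G :: "'a \<Rightarrow> nat \<times> nat \<times> nat" where FG:
    "\<forall>d u. d \<in> pverts T \<longrightarrow> u \<in> pverts T \<longrightarrow> even (h d) \<longrightarrow> odd (h u) \<longrightarrow>
      ((d, u) \<in> parcs T \<longleftrightarrow> F d < F u \<and> G u < G d) \<and> F d \<noteq> F u \<and> G d \<noteq> G u" by (elim exE)
  show "representable_12 T"
  proof (rule two_orders_representable[where U = "{v. odd (h v)}" and F = F and G = G])
    show "finite (pverts T)" by (rule T.pair_finite_verts)
    show "sym (parcs T)" by (auto intro: symI T.arcs_symmetric)
    show "parcs T \<subseteq> pverts T \<times> pverts T" by (auto dest: T.wellformed')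
    show "x \<in> {v. odd (h v)} \<longleftrightarrow> y \<notin> {v. odd (h v)}" if "(x, y) \<in> parcs T" for x y
      using that par(2)[of x] par(2)[of y] by (auto simp: adj)
  qed (use FG in simp_all)
qed

end
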